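(* Let $G=H\rtimes K$ be a semidirect product of groups and let $\theta=\begin{pmatrix}\alpha&\beta\\ \gamma&\delta\end{pmatrix}\in\mathcal{A}$, with $\alpha:H\to H$ and $\delta:K\to K$ invertible, so that $\Delta_{H}=\det_{H}(\theta)=\alpha-\beta\delta^{-1}\gamma: H\to H$ and $\Delta_{K}=\det_{K}(\theta)=-\gamma\alpha^{-1}\beta+\delta: K\to K$ are both defined. Then $\Delta_{H}$ is invertible if and only if $\Delta_{K}$ is invertible. Moreover, $$\Delta_{H}^{-1}=\alpha^{-1}-\alpha^{-1}\beta\Delta_{K}^{-1}(-\gamma\alpha^{-1})\qquad\text{and}\qquad \Delta_{K}^{-1}=\delta^{-1}\gamma\Delta_{H}^{-1}(-\beta\delta^{-1})+\delta^{-1}.$$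
   Context: $K$ acts on $H$ by automorphisms, written $h^{k}$; in $G=H\rtimes K$ we have $h^{k}=khk^{-1}$ and every element of $G$ is uniquely $hk$ with $h\in H$, $k\in K$. An endomorphism $\theta$ of $G$ is identified with the matrix $\begin{pmatrix}\alpha&\beta\\ \gamma&\delta\end{pmatrix}$ of maps $\alpha:H\to H$, $\beta:K\to H$, $\gamma:H\to K$, $\delta:K\to K$ determined by $\theta(h)=\alpha(h)\gamma(h)$ and $\theta(k)=\beta(k)\delta(k)$ for all $h\in H$, $k\in K$. The set $\mathcal{A}$ consists of all such matrices with $\alpha,\beta$ maps of sets, $\gamma\in Hom(H,K)$, $\delta\in End(K)$ satisfying, for all $h,h'\in H$, $k,k'\in K$: (A1) $\alpha(hh')=\alpha(h)\alpha(h')^{\gamma(h)}$; (A2) $\beta(kk')=\beta(k)\beta(k')^{\delta(k)}$; (A3) $\gamma(h^{k})\delta(k)=\delta(k)\gamma(h)$; (A4) $\alpha(h^{k})\beta(k)^{\gamma(h^{k})}=\beta(k)\alpha(h)^{\delta(k)}$; (A5) for any $h'k'\in G$ there exist unique $h\in H$, $k\in K$ with $h'=\alpha(h)\beta(k)^{\gamma(h)}$ and $k'=\gamma(h)\delta(k)$. Thus $\mathcal{A}$ corresponds to $Aut(G)$. "Invertible" for a map means bijective. Sums and negatives of maps are pointwise: $(\phi+\psi)(u)=\phi(u)\psi(u)$, $(-\phi)(u)=\phi(u)^{-1}$, $\phi-\psi=\phi+(-\psi)$; juxtaposition is composition, and a leading minus sign applies to the whole composite following it, e.g. $-\gamma\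alpha^{-1}\beta=-(\gamma\alpha^{-1}\beta)$.
   Formalization: The formula for $\Delta_K^{-1}$ is proved with a leading minus, $-\delta^{-1}\gamma\Delta_H^{-1}(-\beta\delta^{-1})+\delta^{-1}$; as printed it fails for $H=K=\mathbb{Z}$, trivial action, $\alpha=\beta=\delta=\mathrm{id}$, $\gamma(x)=2x$. *)

theory Defs
  imports "HOL-Algebra.Bij"
begin

text \<open>
  A left action of \<open>K\<close> on \<open>H\<close> by automorphisms is a homomorphism
  \<open>\<phi> \<in> hom K (AutoGroup H)\<close>, and \<open>h\<^sup>k\<close> is \<open>\<phi> k h\<close>. The pair \<open>(h, k)\<close> stands for the
  product \<open>h k\<close>, so that \<open>k h = h\<^sup>k k\<close> becomes the multiplication rule below.
\<close>

definition semidirect_product ::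
  "('h, 'm) monoid_scheme \<Rightarrow> ('k, 'n) monoid_scheme \<Rightarrow> ('k \<Rightarrow> 'h \<Rightarrow> 'h) \<Rightarrow> ('h \<times> 'k) monoid"
  where "semidirect_product H K \<phi> =
    \<lparr>carrier = carrier H \<times> carrier K,
     mult = (\<lambda>(h, k) (h', k'). (h \<otimes>\<^bsub>H\<^esub> \<phi> k h', k \<otimes>\<^bsub>K\<^esub> k')),
     one = (\<one>\<^bsub>H\<^esub>, \<one>\<^bsub>K\<^esub>)\<rparr>"

type_synonym ('h, 'k) endo_matrix =
  "('h \<Rightarrow> 'h) \<times> ('k \<Rightarrow> 'h) \<times> ('h \<Rightarrow> 'k) \<times> ('k \<Rightarrow> 'k)"

text \<open>
  The matrix with rows \<open>\<alpha> \<beta>\<close> and \<open>\<gamma> \<delta>\<close> is the tuple \<open>(\<alpha>, \<beta>, \<gamma>, \<delta>)\<close>. The entries matter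
  only on the carriers; their values elsewhere are unconstrained.
\<close>

definition aut_matrices ::
  "('h, 'm) monoid_scheme \<Rightarrow> ('k, 'n) monoid_scheme \<Rightarrow> ('k \<Rightarrow> 'h \<Rightarrow> 'h)
    \<Rightarrow> ('h, 'k) endo_matrix set"
  where "aut_matrices H K \<phi> = {(\<alpha>, \<beta>, \<gamma>, \<delta>).
    \<alpha> \<in> carrier H \<rightarrow> carrier H \<and> \<beta> \<in> carrier K \<rightarrow> carrier H \<and>
    \<gamma> \<in> hom H K \<and> \<delta> \<in> hom K K \<and>
    (\<forall>h\<in>carrier H. \<forall>h'\<in>carrier H. \<alpha> (h \<otimes>\<^bsub>H\<^esub> h') = \<alpha> h \<otimes>\<^bsub>H\<^esub> \<phi> (\<gamma> h) (\<alpha> h')) \<and>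
    (\<forall>k\<in>carrier K. \<forall>k'\<in>carrier K. \<beta> (k \<otimes>\<^bsub>K\<^esub> k') = \<beta> k \<otimes>\<^bsub>H\<^esub> \<phi> (\<delta> k) (\<beta> k')) \<and>
    (\<forall>h\<in>carrier H. \<forall>k\<in>carrier K. \<gamma> (\<phi> k h) \<otimes>\<^bsub>K\<^esub> \<delta> k = \<delta> k \<otimes>\<^bsub>K\<^esub> \<gamma> h) \<and>
    (\<forall>h\<in>carrier H. \<forall>k\<in>carrier K.
       \<alpha> (\<phi> k h) \<otimes>\<^bsub>H\<^esub> \<phi> (\<gamma> (\<phi> k h)) (\<beta> k) = \<beta> k \<otimes>\<^bsub>H\<^esub> \<phi> (\<delta> k) (\<alpha> h)) \<and>
    (\<forall>(h', k') \<in> carrier (semidirect_product H K \<phi>).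
       \<exists>!p. p \<in> carrier H \<times> carrier K \<and>
            (case p of (h, k) \<Rightarrow>
               h' = \<alpha> h \<otimes>\<^bsub>H\<^esub> \<phi> (\<gamma> h) (\<beta> k) \<and> k' = \<gamma> h \<otimes>\<^bsub>K\<^esub> \<delta> k))}"

definition map_plus :: "('b, 'm) monoid_scheme \<Rightarrow> ('a \<Rightarrow> 'b) \<Rightarrow> ('a \<Rightarrow> 'b) \<Rightarrow> 'a \<Rightarrow> 'b"
  where "map_plus M f g = (\<lambda>u. f u \<otimes>\<^bsub>M\<^esub> g u)"

definition map_uminus :: "('b, 'm) monoid_scheme \<Rightarrow> ('a \<Rightarrow> 'b) \<Rightarrow> 'a \<Rightarrow> 'b"
  where "map_uminus M f = (\<lambda>u. inv\<^bsub>M\<^esub> (f u))"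

definition map_minus :: "('b, 'm) monoid_scheme \<Rightarrow> ('a \<Rightarrow> 'b) \<Rightarrow> ('a \<Rightarrow> 'b) \<Rightarrow> 'a \<Rightarrow> 'b"
  where "map_minus M f g = map_plus M f (map_uminus M g)"

abbreviation carrier_inv :: "('a, 'm) monoid_scheme \<Rightarrow> ('a \<Rightarrow> 'a) \<Rightarrow> 'a \<Rightarrow> 'a"
  where "carrier_inv M f \<equiv> inv_into (carrier M) f"

abbreviation invertible_on :: "('a, 'm) monoid_scheme \<Rightarrow> ('a \<Rightarrow> 'a) \<Rightarrow> bool"
  where "invertible_on M f \<equiv> bij_betw f (carrier M) (carrier M)"

text \<open>\<open>det_H\<close> is meaningful only if \<open>\<delta>\<close> is invertible, \<open>det_K\<close> only if \<open>\<alpha>\<close> is.\<close>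

definition det_H ::
  "('h, 'm) monoid_scheme \<Rightarrow> ('k, 'n) monoid_scheme \<Rightarrow> ('h, 'k) endo_matrix \<Rightarrow> 'h \<Rightarrow> 'h"
  where "det_H H K = (\<lambda>(\<alpha>, \<beta>, \<gamma>, \<delta>). map_minus H \<alpha> (\<beta> \<circ> carrier_inv K \<delta> \<circ> \<gamma>))"

definition det_K ::
  "('h, 'm) monoid_scheme \<Rightarrow> ('k, 'n) monoid_scheme \<Rightarrow> ('h, 'k) endo_matrix \<Rightarrow> 'k \<Rightarrow> 'k"
  where "det_K H K = (\<lambda>(\<alpha>, \<beta>, \<gamma>, \<delta>).
    map_plus K (map_uminus K (\<gamma> \<circ> carrier_inv H \<alpha> \<circ> \<beta>)) \<delta>)"

text \<open>
  Pitfall: the inverse of \<open>det_K\<close> is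
  \<open>- \<delta>\<^sup>-\<^sup>1 \<gamma> \<Delta>\<^sub>H\<^sup>-\<^sup>1 (- \<beta> \<delta>\<^sup>-\<^sup>1) + \<delta>\<^sup>-\<^sup>1\<close>, with a minus sign in front of the composite
  that the source omits. Without it the formula fails for \<open>H = K = \<int>\<close>, trivial action,
  \<open>\<alpha> = \<beta> = \<delta> = id\<close>, \<open>\<gamma> x = 2 x\<close>: both determinants are \<open>x \<mapsto> - x\<close>, but the formula
  without the sign gives \<open>x \<mapsto> 3 x\<close>.
\<close>

end

theory Submission
  imports Defs
begin

text \<open>
  Let \<open>\<theta>\<close> be the bijection \<open>(h, k) \<mapsto> (\<alpha>(h) \<beta>(k)\<^bsup>\<gamma>(h)\<^esup>, \<gamma>(h) \<delta>(k))\<close> of \<open>G\<close>. The elements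
  that \<open>\<theta>\<close> sends into \<open>H\<close> are exactly the \<open>h (\<delta>\<^sup>-\<^sup>1\<gamma>(h))\<^sup>-\<^sup>1\<close>, with image \<open>\<Delta>\<^sub>H(h)\<close>, and those
  that it sends into \<open>K\<close> are exactly the \<open>(\<alpha>\<^sup>-\<^sup>1\<beta>(k))\<^sup>-\<^sup>1 k\<close>, with image \<open>\<Delta>\<^sub>K(k)\<close>. Hence both
  determinants are always bijective. The formulas for the inverses come from multiplying
  \<open>\<theta>(\<alpha>\<^sup>-\<^sup>1(h)) = h \<gamma>\<alpha>\<^sup>-\<^sup>1(h)\<close> on the right by a preimage of \<open>(\<gamma>\<alpha>\<^sup>-\<^sup>1(h))\<^sup>-\<^sup>1\<close>, and
  \<open>\<theta>(\<delta>\<^sup>-\<^sup>1(k)) = \<beta>\<delta>\<^sup>-\<^sup>1(k) k\<close> on the left by a preimage of \<open>(\<beta>\<delta>\<^sup>-\<^sup>1(k))\<^sup>-\<^sup>1\<close>.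
\<close>

section \<open>Actions by automorphisms\<close>

locale group_action_by_auts = H: group H + K: group K
  for H :: "('h, 'm) monoid_scheme" (structure) and K :: "('k, 'n) monoid_scheme" (structure) +
  fixes \<phi> :: "'k \<Rightarrow> 'h \<Rightarrow> 'h"
  assumes action_hom: "\<phi> \<in> hom K (AutoGroup H)"
begin

lemma action_auto: "k \<in> carrier K \<Longrightarrow> \<phi> k \<in> auto H"
  using action_hom by (auto simp: hom_def AutoGroup_def)

lemma action_is_hom: "k \<in> carrier K \<Longrightarrow> group_hom H H (\<phi> k)"
  using action_auto
  by (intro group_hom.intro H.is_group group_hom_axioms.intro) (simp add: auto_def)

lemma action_closed [simp]:
  "k \<in> carrier K \<Longrightarrow> h \<in> carrier H \<Longrightarrow> \<phi> k h \<in> carrier H"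
  using action_is_hom by (rule group_hom.hom_closed)

lemma action_mult:
  assumes "k \<in> carrier K" "h \<in> carrier H" "h' \<in> carrier H"
  shows "\<phi> k (h \<otimes>\<^bsub>H\<^esub> h') = \<phi> k h \<otimes>\<^bsub>H\<^esub> \<phi> k h'"
  using assms action_is_hom by (simp add: group_hom.hom_mult)

lemma action_comp:
  assumes "k \<in> carrier K" "k' \<in> carrier K" "h \<in> carrier H"
  shows "\<phi> (k \<otimes>\<^bsub>K\<^esub> k') h = \<phi> k (\<phi> k' h)"
proof -
  have "\<phi> (k \<otimes>\<^bsub>K\<^esub> k') = \<phi> k \<otimes>\<^bsub>AutoGroup H\<^esub> \<phi> k'"
    using action_hom assms by (simp add: hom_mult)
  \<comment> \<open>Multiplication in \<open>AutoGroup H\<close> is composition restricted to the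
    carrier, so it can be evaluated only at points of \<open>carrier H\<close>.\<close>
  also have "\<dots> = compose (carrier H) (\<phi> k) (\<phi> k')"
    using action_auto assms by (simp add: AutoGroup_def BijGroup_def auto_def)
  finally show ?thesis
    using assms by (simp add: compose_def)
qed

text \<open>By \<open>action_comp\<close> the unit of \<open>K\<close> acts idempotently, and an
  injective idempotent map fixes every point.\<close>

lemma action_one [simp]:
  assumes "h \<in> carrier H"
  shows "\<phi> \<one>\<^bsub>K\<^esub> h = h"
proof -
  have "\<phi> \<one>\<^bsub>K\<^esub> (\<phi> \<one>\<^bsub>K\<^esub> h) = \<phi> \<one>\<^bsub>K\<^esub> h"
    using action_comp[of "\<one>\<^bsub>K\<^esub>" "\<one>\<^bsub>K\<^esub>" h] assms by simp
  moreover have "inj_on (\<phi> \<one>\<^bsub>K\<^esub>) (carrier H)"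
    using action_auto[of "\<one>\<^bsub>K\<^esub>"] by (simp add: auto_def Bij_def bij_betw_def)
  ultimately show ?thesis
    using assms by (simp add: inj_on_eq_iff)
qed

lemma action_inv_left [simp]:
  "k \<in> carrier K \<Longrightarrow> h \<in> carrier H \<Longrightarrow> \<phi> k (\<phi> (inv\<^bsub>K\<^esub> k) h) = h"
  by (simp flip: action_comp)

end

text \<open>\<open>\<sigma>\<close> is a crossed homomorphism for the action of \<open>G\<close> on
  \<open>H\<close> through \<open>\<epsilon>\<close>. Its rule makes the value at the unit
  idempotent, hence trivial, and is then applied to \<open>x\<close> times its inverse. A general
  \<open>G\<close> covers both \<alpha> (twisted by \<gamma>, with \<open>G = H\<close>) and \<beta>
  (twisted by \<delta>, with \<open>G = K\<close>).\<close>

lemma crossed_hom_inv: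
  assumes "group G" "group_action_by_auts H K \<phi>" "\<epsilon> \<in> hom G K" "\<sigma> \<in> carrier G \<rightarrow> carrier H"
    and crossed: "\<And>x y. x \<in> carrier G \<Longrightarrow> y \<in> carrier G \<Longrightarrow>
      \<sigma> (x \<otimes>\<^bsub>G\<^esub> y) = \<sigma> x \<otimes>\<^bsub>H\<^esub> \<phi> (\<epsilon> x) (\<sigma> y)"
    and x: "x \<in> carrier G"
  shows "\<phi> (\<epsilon> x) (\<sigma> (inv\<^bsub>G\<^esub> x)) = inv\<^bsub>H\<^esub> (\<sigma> x)"
proof -
  interpret G: group G by fact
  interpret group_action_by_auts H K \<phi> by fact
  have \<epsilon>: "\<And>y. y \<in> carrier G \<Longrightarrow> \<epsilon> y \<in> carrier K" and \<sigma>: "\<And>y. y \<in> carrier G \<Longrightarrow> \<sigma> y \<in> carrier H"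
    using assms by (auto simp: hom_def)
  have "\<epsilon> \<one>\<^bsub>G\<^esub> = \<one>\<^bsub>K\<^esub>"
    using assms(3) by (simp add: hom_one G.is_group K.is_group)
  then have "\<sigma> \<one>\<^bsub>G\<^esub> = \<sigma> \<one>\<^bsub>G\<^esub> \<otimes>\<^bsub>H\<^esub> \<sigma> \<one>\<^bsub>G\<^esub>"
    using crossed[of "\<one>\<^bsub>G\<^esub>" "\<one>\<^bsub>G\<^esub>"] \<sigma> by simp
  then have "\<sigma> \<one>\<^bsub>G\<^esub> = \<one>\<^bsub>H\<^esub>"
    using \<sigma> by (metis G.one_closed H.l_cancel_one')
  then have "\<sigma> x \<otimes>\<^bsub>H\<^esub> \<phi> (\<epsilon> x) (\<sigma> (inv\<^bsub>G\<^esub> x)) = \<one>\<^bsub>H\<^esub>"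
    using crossed[of x "inv\<^bsub>G\<^esub> x"] x by simp
  then show ?thesis
    using x \<sigma> \<epsilon> by (metis G.inv_closed H.inv_solve_left' H.r_one H.one_closed H.inv_closed action_closed)
qed

section \<open>Automorphism matrices and the bijection \<open>\<theta>\<close>\<close>

locale aut_matrix = group_action_by_auts H K \<phi>
  for H :: "('h, 'm) monoid_scheme" (structure) and K :: "('k, 'n) monoid_scheme" (structure)
    and \<phi> :: "'k \<Rightarrow> 'h \<Rightarrow> 'h" +
  fixes \<alpha> :: "'h \<Rightarrow> 'h" and \<beta> :: "'k \<Rightarrow> 'h" and \<gamma> :: "'h \<Rightarrow> 'k" and \<delta> :: "'k \<Rightarrow> 'k"
  assumes aut_matrix: "(\<alpha>, \<beta>, \<gamma>, \<delta>) \<in> aut_matrices H K \<phi>"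
    and \<alpha>_bij: "invertible_on H \<alpha>" and \<delta>_bij: "invertible_on K \<delta>"
begin

text \<open>The normal form of the image \<alpha>(h) \<gamma>(h) \<beta>(k) \<delta>(k) of h k:
  moving \<gamma>(h) to the right past \<beta>(k) makes it act on \<beta>(k).\<close>

definition \<theta> :: "'h \<times> 'k \<Rightarrow> 'h \<times> 'k"
  where "\<theta> = (\<lambda>(h, k). (\<alpha> h \<otimes>\<^bsub>H\<^esub> \<phi> (\<gamma> h) (\<beta> k), \<gamma> h \<otimes>\<^bsub>K\<^esub> \<delta> k))"

abbreviation "\<Delta>\<^sub>H \<equiv> det_H H K (\<alpha>, \<beta>, \<gamma>, \<delta>)"
abbreviation "\<Delta>\<^sub>K \<equiv> det_K H K (\<alpha>, \<beta>, \<gamma>, \<delta>)"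
abbreviation "\<alpha>' \<equiv> carrier_inv H \<alpha>"
abbreviation "\<delta>' \<equiv> carrier_inv K \<delta>"

lemma \<gamma>_hom: "\<gamma> \<in> hom H K" and \<delta>_hom: "\<delta> \<in> hom K K"
  using aut_matrix by (auto simp: aut_matrices_def)

sublocale \<gamma>: group_hom H K \<gamma>
  by (intro group_hom.intro H.is_group K.is_group group_hom_axioms.intro \<gamma>_hom)

sublocale \<delta>: group_hom K K \<delta>
  by (intro group_hom.intro K.is_group group_hom_axioms.intro \<delta>_hom)

lemma
  shows \<alpha>_closed [simp]: "h \<in> carrier H \<Longrightarrow> \<alpha> h \<in> carrier H"
    and \<beta>_closed [simp]: "k \<in> carrier K \<Longrightarrow> \<beta> k \<in> carrier H"
    and \<alpha>_mult: "\<lbrakk>h \<in> carrier H; h\<^sub>1 \<in> carrier H\<rbrakk> \<Longrightarrow> \<alpha> (h \<otimes>\<^bsub>H\<^esub> h\<^sub>1) = \<alpha> h \<otimes>\<^bsub>H\<^esub> \<phi> (\<gamma> h) (\<alpha> h\<^sub>1)"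
    and \<beta>_mult: "\<lbrakk>k \<in> carrier K; k\<^sub>1 \<in> carrier K\<rbrakk> \<Longrightarrow> \<beta> (k \<otimes>\<^bsub>K\<^esub> k\<^sub>1) = \<beta> k \<otimes>\<^bsub>H\<^esub> \<phi> (\<delta> k) (\<beta> k\<^sub>1)"
  using aut_matrix by (auto simp: aut_matrices_def)

lemma \<alpha>_inv: "h \<in> carrier H \<Longrightarrow> \<phi> (\<gamma> h) (\<alpha> (inv\<^bsub>H\<^esub> h)) = inv\<^bsub>H\<^esub> (\<alpha> h)"
  by (rule crossed_hom_inv[OF H.is_group group_action_by_auts_axioms \<gamma>_hom]) (auto simp: \<alpha>_mult)

lemma \<beta>_inv: "k \<in> carrier K \<Longrightarrow> \<phi> (\<delta> k) (\<beta> (inv\<^bsub>K\<^esub> k)) = inv\<^bsub>H\<^esub> (\<beta> k)"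
  by (rule crossed_hom_inv[OF K.is_group group_action_by_auts_axioms \<delta>_hom]) (auto simp: \<beta>_mult)

lemma
  shows \<alpha>'_closed [simp]: "h \<in> carrier H \<Longrightarrow> \<alpha>' h \<in> carrier H"
    and \<delta>'_closed [simp]: "k \<in> carrier K \<Longrightarrow> \<delta>' k \<in> carrier K"
    and \<alpha>_\<alpha>' [simp]: "h \<in> carrier H \<Longrightarrow> \<alpha> (\<alpha>' h) = h"
    and \<delta>_\<delta>' [simp]: "k \<in> carrier K \<Longrightarrow> \<delta> (\<delta>' k) = k"
    and \<alpha>'_\<alpha> [simp]: "h \<in> carrier H \<Longrightarrow> \<alpha>' (\<alpha> h) = h"
    and \<delta>'_\<delta> [simp]: "k \<in> carrier K \<Longrightarrow> \<delta>' (\<delta> k) = k"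
  using \<alpha>_bij \<delta>_bij
  by (auto simp: bij_betw_def f_inv_into_f intro: inv_into_into)

lemma \<Delta>\<^sub>H_apply: "\<Delta>\<^sub>H h = \<alpha> h \<otimes>\<^bsub>H\<^esub> inv\<^bsub>H\<^esub> (\<beta> (\<delta>' (\<gamma> h)))"
  by (simp add: det_H_def map_minus_def map_plus_def map_uminus_def)

lemma \<Delta>\<^sub>K_apply: "\<Delta>\<^sub>K k = inv\<^bsub>K\<^esub> (\<gamma> (\<alpha>' (\<beta> k))) \<otimes>\<^bsub>K\<^esub> \<delta> k"
  by (simp add: det_K_def map_plus_def map_uminus_def)

text \<open>This is the last clause of \<open>aut_matrices\<close>: every pair has exactly one
  preimage.\<close>

lemma \<theta>_bij: "bij_betw \<theta> (carrier H \<times> carrier K) (carrier H \<times> carrier K)"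
proof -
  have unique: "\<exists>!p. p \<in> carrier H \<times> carrier K \<and> q = \<theta> p" if "q \<in> carrier H \<times> carrier K" for q
    using aut_matrix that
    by (simp add: aut_matrices_def semidirect_product_def \<theta>_def split_def prod_eq_iff mem_Times_iff)
  have closed: "\<theta> p \<in> carrier H \<times> carrier K" if "p \<in> carrier H \<times> carrier K" for p
    using that by (auto simp: \<theta>_def)
  show ?thesis
    unfolding bij_betw_def
  proof
    show "inj_on \<theta> (carrier H \<times> carrier K)"
      using unique[OF closed] by (blast intro: inj_onI)
    show "\<theta> ` (carrier H \<times> carrier K) = carrier H \<times> carrier K"
      using unique closed by blast
  qed
qed

lemma \<theta>_surj:
  assumes "h' \<in> carrier H" "k' \<in> carrier K"
  obtains h k where "h \<in> carrier H" "k \<in> carrier K" "\<theta> (h, k) = (h', k')"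
proof -
  have "(h', k') \<in> \<theta> ` (carrier H \<times> carrier K)"
    using \<theta>_bij assms by (simp add: bij_betw_def)
  then show thesis
    using that by auto
qed

lemma \<theta>_inj:
  assumes "\<theta> (h, k) = \<theta> (h\<^sub>1, k\<^sub>1)" "h \<in> carrier H" "k \<in> carrier K" "h\<^sub>1 \<in> carrier H" "k\<^sub>1 \<in> carrier K"
  shows "h = h\<^sub>1" "k = k\<^sub>1"
  using bij_betw_imp_inj_on[OF \<theta>_bij] assms by (auto dest: inj_onD)

text \<open>Multiplicativity for a left factor from \<open>H\<close>: x (h k) = (x h) k is already
  in normal form, so the crossed rule for \<alpha> applies directly. The result is the product of
  \<alpha>(x) \<gamma>(x) and h' k' in G.\<close>

lemma \<theta>_left_mult:
  assumes "x \<in> carrier H" "h \<in> carrier H" "k \<in> carrier K" "\<theta> (h, k) = (h', k')"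
  shows "\<theta> (x \<otimes>\<^bsub>H\<^esub> h, k) = (\<alpha> x \<otimes>\<^bsub>H\<^esub> \<phi> (\<gamma> x) h', \<gamma> x \<otimes>\<^bsub>K\<^esub> k')"
  using assms by (auto simp: \<theta>_def \<alpha>_mult action_mult action_comp H.m_assoc K.m_assoc)

text \<open>The mirror case: a right factor from \<open>K\<close> changes only the second
  coordinate, so the crossed rule for \<beta> applies.\<close>

lemma \<theta>_right_mult:
  assumes "y \<in> carrier K" "h \<in> carrier H" "k \<in> carrier K" "\<theta> (h, k) = (h', k')"
  shows "\<theta> (h, k \<otimes>\<^bsub>K\<^esub> y) = (h' \<otimes>\<^bsub>H\<^esub> \<phi> k' (\<beta> y), k' \<otimes>\<^bsub>K\<^esub> \<delta> y)"
  using assms by (auto simp: \<theta>_def \<beta>_mult action_mult action_comp H.m_assoc K.m_assoc)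

lemma \<theta>_in_H_iff:
  assumes h: "h \<in> carrier H" and k: "k \<in> carrier K"
  shows "\<theta> (h, k) = (h', \<one>\<^bsub>K\<^esub>) \<longleftrightarrow> k = inv\<^bsub>K\<^esub> (\<delta>' (\<gamma> h)) \<and> h' = \<Delta>\<^sub>H h"
proof -
  have "\<gamma> h \<otimes>\<^bsub>K\<^esub> \<delta> k = \<one>\<^bsub>K\<^esub> \<longleftrightarrow> \<delta> k = inv\<^bsub>K\<^esub> (\<gamma> h)"
    using h k by (metis K.inv_equality K.inv_inv K.r_inv \<delta>.hom_closed \<gamma>.hom_closed)
  also have "\<dots> \<longleftrightarrow> \<delta> k = \<delta> (inv\<^bsub>K\<^esub> (\<delta>' (\<gamma> h)))"
    using h by simp
  also have "\<dots> \<longleftrightarrow> k = inv\<^bsub>K\<^esub> (\<delta>' (\<gamma> h))"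
    using h k by (metis K.inv_closed \<delta>'_\<delta> \<delta>'_closed \<gamma>.hom_closed)
  finally have "\<gamma> h \<otimes>\<^bsub>K\<^esub> \<delta> k = \<one>\<^bsub>K\<^esub> \<longleftrightarrow> k = inv\<^bsub>K\<^esub> (\<delta>' (\<gamma> h))" .
  \<comment> \<open>At \<open>\<delta>' (\<gamma> h)\<close> the twist in \<open>\<beta>_inv\<close>
    is by \<open>\<gamma> h\<close>, exactly the one in the first component of
    \<open>\<theta>\<close>.\<close>
  moreover have "\<phi> (\<gamma> h) (\<beta> (inv\<^bsub>K\<^esub> (\<delta>' (\<gamma> h)))) = inv\<^bsub>H\<^esub> (\<beta> (\<delta>' (\<gamma> h)))"
    using \<beta>_inv[of "\<delta>' (\<gamma> h)"] h by simp
  ultimately show ?thesis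
    by (auto simp: \<theta>_def \<Delta>\<^sub>H_apply)
qed

lemma \<theta>_in_K_iff:
  assumes h: "h \<in> carrier H" and k: "k \<in> carrier K"
  shows "\<theta> (h, k) = (\<one>\<^bsub>H\<^esub>, k') \<longleftrightarrow> h = inv\<^bsub>H\<^esub> (\<alpha>' (\<beta> k)) \<and> k' = \<Delta>\<^sub>K k"
proof -
  \<comment> \<open>Since \<alpha> is only a crossed homomorphism, its value at an inverse carries a
    twist by \<open>\<gamma> h\<close>; the same twist sits on \<open>b\<close>, and injectivity of
    \<open>\<phi> (\<gamma> h)\<close> cancels both.\<close>
  have *: "\<alpha> h \<otimes>\<^bsub>H\<^esub> \<phi> (\<gamma> h) b = \<one>\<^bsub>H\<^esub> \<longleftrightarrow> \<alpha> (inv\<^bsub>H\<^esub> h) = b" if b: "b \<in> carrier H" for b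
  proof -
    have "\<alpha> h \<otimes>\<^bsub>H\<^esub> \<phi> (\<gamma> h) b = \<one>\<^bsub>H\<^esub> \<longleftrightarrow> \<phi> (\<gamma> h) b = inv\<^bsub>H\<^esub> (\<alpha> h)"
      using h b by (metis H.inv_equality H.inv_inv H.r_inv \<alpha>_closed action_closed \<gamma>.hom_closed)
    also have "\<dots> \<longleftrightarrow> \<phi> (\<gamma> h) b = \<phi> (\<gamma> h) (\<alpha> (inv\<^bsub>H\<^esub> h))"
      using h by (simp add: \<alpha>_inv)
    also have "\<dots> \<longleftrightarrow> b = \<alpha> (inv\<^bsub>H\<^esub> h)"
      using action_auto[of "\<gamma> h"] h b
      by (auto simp: auto_def Bij_def bij_betw_def dest: inj_onD)
    finally show ?thesis by auto
  qed
  have "\<alpha> (inv\<^bsub>H\<^esub> h) = \<beta> k \<longleftrightarrow> inv\<^bsub>H\<^esub> h = \<alpha>' (\<beta> k)"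
    using h k by (metis H.inv_closed \<alpha>'_\<alpha> \<alpha>_\<alpha>' \<beta>_closed)
  also have "\<dots> \<longleftrightarrow> h = inv\<^bsub>H\<^esub> (\<alpha>' (\<beta> k))"
    using h k by (metis H.inv_inv \<alpha>'_closed \<beta>_closed)
  finally show ?thesis
    using h k by (auto simp: \<theta>_def \<Delta>\<^sub>K_apply *)
qed

section \<open>Bijectivity of the two determinants\<close>

lemma \<Delta>\<^sub>H_bij: "invertible_on H \<Delta>\<^sub>H"
  unfolding bij_betw_def
proof
  \<comment> \<open>Equal values of \<open>\<Delta>\<^sub>H\<close> give equal images under
    \<open>\<theta>\<close>, hence equal pairs, whose first coordinates are the arguments.\<close>
  have \<theta>: "\<theta> (h, inv\<^bsub>K\<^esub> (\<delta>' (\<gamma> h))) = (\<Delta>\<^sub>H h, \<one>\<^bsub>K\<^esub>)" if "h \<in> carrier H" for h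
    using that by (simp add: \<theta>_in_H_iff)
  show "inj_on \<Delta>\<^sub>H (carrier H)"
  proof (rule inj_onI)
    fix x y assume "x \<in> carrier H" "y \<in> carrier H" "\<Delta>\<^sub>H x = \<Delta>\<^sub>H y"
    then show "x = y"
      by (intro \<theta>_inj(1)[of x "inv\<^bsub>K\<^esub> (\<delta>' (\<gamma> x))" y "inv\<^bsub>K\<^esub> (\<delta>' (\<gamma> y))"]) (simp_all add: \<theta>)
  qed
  show "\<Delta>\<^sub>H ` carrier H = carrier H"
  proof
    show "\<Delta>\<^sub>H ` carrier H \<subseteq> carrier H"
      by (auto simp: \<Delta>\<^sub>H_apply)
    show "carrier H \<subseteq> \<Delta>\<^sub>H ` carrier H"
    proof
      fix h' assume "h' \<in> carrier H"
      then obtain h k where "h \<in> carrier H" "k \<in> carrier K" "\<theta> (h, k) = (h', \<one>\<^bsub>K\<^esub>)"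
        by (rule \<theta>_surj[OF _ K.one_closed])
      \<comment> \<open>A preimage of an element of \<open>H\<close> has its second coordinate
        forced, so its first coordinate is the required argument of
        \<open>\<Delta>\<^sub>H\<close>.\<close>
      then show "h' \<in> \<Delta>\<^sub>H ` carrier H"
        using \<theta>_in_H_iff by blast
    qed
  qed
qed

lemma \<Delta>\<^sub>K_bij: "invertible_on K \<Delta>\<^sub>K"
  unfolding bij_betw_def
proof
  \<comment> \<open>Now the second coordinate is the free parameter and the first is determined by
    it.\<close>
  have \<theta>: "\<theta> (inv\<^bsub>H\<^esub> (\<alpha>' (\<beta> k)), k) = (\<one>\<^bsub>H\<^esub>, \<Delta>\<^sub>K k)" if "k \<in> carrier K" for k
    using that by (simp add: \<theta>_in_K_iff)
  show "inj_on \<Delta>\<^sub>K (carrier K)"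
  proof (rule inj_onI)
    fix x y assume "x \<in> carrier K" "y \<in> carrier K" "\<Delta>\<^sub>K x = \<Delta>\<^sub>K y"
    then show "x = y"
      by (intro \<theta>_inj(2)[of "inv\<^bsub>H\<^esub> (\<alpha>' (\<beta> x))" x "inv\<^bsub>H\<^esub> (\<alpha>' (\<beta> y))" y]) (simp_all add: \<theta>)
  qed
  show "\<Delta>\<^sub>K ` carrier K = carrier K"
  proof
    show "\<Delta>\<^sub>K ` carrier K \<subseteq> carrier K"
      by (auto simp: \<Delta>\<^sub>K_apply)
    show "carrier K \<subseteq> \<Delta>\<^sub>K ` carrier K"
    proof
      fix k' assume "k' \<in> carrier K"
      then obtain h k where "h \<in> carrier H" "k \<in> carrier K" "\<theta> (h, k) = (\<one>\<^bsub>H\<^esub>, k')"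
        by (rule \<theta>_surj[OF H.one_closed])
      then show "k' \<in> \<Delta>\<^sub>K ` carrier K"
        using \<theta>_in_K_iff by blast
    qed
  qed
qed

section \<open>Formulas for the inverse determinants\<close>

lemma \<Delta>\<^sub>H_inverse:
  assumes h: "h \<in> carrier H"
  shows "carrier_inv H \<Delta>\<^sub>H h =
    \<alpha>' h \<otimes>\<^bsub>H\<^esub> inv\<^bsub>H\<^esub> (\<alpha>' (\<beta> (carrier_inv K \<Delta>\<^sub>K (inv\<^bsub>K\<^esub> (\<gamma> (\<alpha>' h))))))"
proof -
  \<comment> \<open>\<open>\<theta>\<close> sends \<open>\<alpha>' h\<close> to h
    \<gamma>(\<open>\<alpha>' h\<close>); \<open>k\<close> is chosen so that
    \<open>\<Delta>\<^sub>K k\<close> cancels the second factor.\<close>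
  define k where "k = carrier_inv K \<Delta>\<^sub>K (inv\<^bsub>K\<^esub> (\<gamma> (\<alpha>' h)))"
  have k: "k \<in> carrier K" and \<Delta>k: "\<Delta>\<^sub>K k = inv\<^bsub>K\<^esub> (\<gamma> (\<alpha>' h))"
    using \<Delta>\<^sub>K_bij h unfolding k_def bij_betw_def
    by (auto simp: f_inv_into_f intro!: inv_into_into)
  have "\<theta> (inv\<^bsub>H\<^esub> (\<alpha>' (\<beta> k)), k) = (\<one>\<^bsub>H\<^esub>, inv\<^bsub>K\<^esub> (\<gamma> (\<alpha>' h)))"
    using k \<Delta>k by (simp add: \<theta>_in_K_iff)
  \<comment> \<open>The image being multiplied has trivial \<open>H\<close>-part, which the twist
    from \<open>\<theta>_left_mult\<close> fixes, so only \<alpha>(\<open>\<alpha>' h\<close>) = h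
    remains.\<close>
  then have "\<theta> (\<alpha>' h \<otimes>\<^bsub>H\<^esub> inv\<^bsub>H\<^esub> (\<alpha>' (\<beta> k)), k) = (h, \<one>\<^bsub>K\<^esub>)"
    using \<theta>_left_mult[of "\<alpha>' h" "inv\<^bsub>H\<^esub> (\<alpha>' (\<beta> k))" k] h k
    by (simp add: group_hom.hom_one[OF action_is_hom])
  then have "\<Delta>\<^sub>H (\<alpha>' h \<otimes>\<^bsub>H\<^esub> inv\<^bsub>H\<^esub> (\<alpha>' (\<beta> k))) = h"
    using \<theta>_in_H_iff h k by simp
  then show ?thesis
    using \<Delta>\<^sub>H_bij h k by (auto simp: bij_betw_def k_def intro!: inv_into_f_eq)
qed

text \<open>The outer inverse is the minus sign discussed with the definitions: it comes from the
  \<open>K\<close>-part of the element h (\<open>\<delta>' (\<gamma> h)\<close>)^-1 that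
  \<open>\<theta>\<close> sends into \<open>H\<close>.\<close>

lemma \<Delta>\<^sub>K_inverse:
  assumes k: "k \<in> carrier K"
  shows "carrier_inv K \<Delta>\<^sub>K k =
    inv\<^bsub>K\<^esub> (\<delta>' (\<gamma> (carrier_inv H \<Delta>\<^sub>H (inv\<^bsub>H\<^esub> (\<beta> (\<delta>' k)))))) \<otimes>\<^bsub>K\<^esub> \<delta>' k"
proof -
  \<comment> \<open>\<open>\<theta>\<close> sends \<open>\<delta>' k\<close> to
    \<beta>(\<open>\<delta>' k\<close>) k; \<open>h\<close> is chosen so that
    \<open>\<Delta>\<^sub>H h\<close> cancels the first factor.\<close>
  define h where "h = carrier_inv H \<Delta>\<^sub>H (inv\<^bsub>H\<^esub> (\<beta> (\<delta>' k)))"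
  have h: "h \<in> carrier H" and \<Delta>h: "\<Delta>\<^sub>H h = inv\<^bsub>H\<^esub> (\<beta> (\<delta>' k))"
    using \<Delta>\<^sub>H_bij k unfolding h_def bij_betw_def
    by (auto simp: f_inv_into_f intro!: inv_into_into)
  have "\<theta> (h, inv\<^bsub>K\<^esub> (\<delta>' (\<gamma> h))) = (inv\<^bsub>H\<^esub> (\<beta> (\<delta>' k)), \<one>\<^bsub>K\<^esub>)"
    using h \<Delta>h by (simp add: \<theta>_in_H_iff)
  then have "\<theta> (h, inv\<^bsub>K\<^esub> (\<delta>' (\<gamma> h)) \<otimes>\<^bsub>K\<^esub> \<delta>' k) = (\<one>\<^bsub>H\<^esub>, k)"
    using \<theta>_right_mult[of "\<delta>' k" h "inv\<^bsub>K\<^esub> (\<delta>' (\<gamma> h))"] h k by simp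
  \<comment> \<open>For an element sent into \<open>K\<close>, the second coordinate is the argument
    of \<open>\<Delta>\<^sub>K\<close>.\<close>
  then have "\<Delta>\<^sub>K (inv\<^bsub>K\<^esub> (\<delta>' (\<gamma> h)) \<otimes>\<^bsub>K\<^esub> \<delta>' k) = k"
    using \<theta>_in_K_iff h k by simp
  then show ?thesis
    using \<Delta>\<^sub>K_bij h k by (auto simp: bij_betw_def h_def intro!: inv_into_f_eq)
qed

end

theorem theorem3p5:
  fixes H :: "('h, 'm) monoid_scheme" and K :: "('k, 'n) monoid_scheme"
    and \<phi> :: "'k \<Rightarrow> 'h \<Rightarrow> 'h"
    and \<alpha> :: "'h \<Rightarrow> 'h" and \<beta> :: "'k \<Rightarrow> 'h" and \<gamma> :: "'h \<Rightarrow> 'k" and \<delta> :: "'k \<Rightarrow> 'k"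
  assumes "group H" and "group K" and "\<phi> \<in> hom K (AutoGroup H)"
    and "(\<alpha>, \<beta>, \<gamma>, \<delta>) \<in> aut_matrices H K \<phi>"
    and "invertible_on H \<alpha>" and "invertible_on K \<delta>"
  defines "\<Delta>\<^sub>H \<equiv> det_H H K (\<alpha>, \<beta>, \<gamma>, \<delta>)"
    and "\<Delta>\<^sub>K \<equiv> det_K H K (\<alpha>, \<beta>, \<gamma>, \<delta>)"
  shows "(invertible_on H \<Delta>\<^sub>H \<longleftrightarrow> invertible_on K \<Delta>\<^sub>K) \<and>
    (invertible_on H \<Delta>\<^sub>H \<longrightarrow>
      (\<forall>h\<in>carrier H. carrier_inv H \<Delta>\<^sub>H h =
         map_minus H (carrier_inv H \<alpha>)
           (carrier_inv H \<alpha> \<circ> \<beta> \<circ> carrier_inv K \<Delta>\<^sub>K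
              \<circ> map_uminus K (\<gamma> \<circ> carrier_inv H \<alpha>)) h) \<and>
      (\<forall>k\<in>carrier K. carrier_inv K \<Delta>\<^sub>K k =
         map_plus K
           (map_uminus K (carrier_inv K \<delta> \<circ> \<gamma> \<circ> carrier_inv H \<Delta>\<^sub>H
              \<circ> map_uminus H (\<beta> \<circ> carrier_inv K \<delta>)))
           (carrier_inv K \<delta>) k))"
proof -
  interpret aut_matrix H K \<phi> \<alpha> \<beta> \<gamma> \<delta>
    using assms(1-6)
    by (intro aut_matrix.intro group_action_by_auts.intro group_action_by_auts_axioms.intro
        aut_matrix_axioms.intro)
  note map_defs = map_minus_def map_plus_def map_uminus_def comp_apply
  \<comment> \<open>Both sides of the equivalence are established facts; unfolding the pointwise
    operations turns the formulas into the two inverse lemmas.\<close>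
  show ?thesis
    unfolding assms(7,8) map_defs
    using \<Delta>\<^sub>H_bij \<Delta>\<^sub>K_bij \<Delta>\<^sub>H_inverse \<Delta>\<^sub>K_inverse by blast
qed

end
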